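(* Let $Q\in\mathbb{Z}^{n\times n}$, $A\in\mathbb{Z}^{m\times n}$, $\mathbf b\in\mathbb{Z}^m$, let $f(\mathbf x)=\mathbf x^tQ\mathbf x$, and consider the problem $(P)$ of minimizing $f(\mathbf x)$ over $\mathbf x\in\{0,1\}^n$ subject to $A\mathbf x=\mathbf b$. Let $\mathbf x_{\mathrm{feas}}\in\{0,1\}^n$ be a feasible point of $(P)$ (i.e. $A\mathbf x_{\mathrm{feas}}=\mathbf b$), let $\delta>0$, and let $f_{\widehat{\mathrm{unc}}}\in\mathbb{R}$ satisfy $f_{\widehat{\mathrm{unc}}}\le\min\{f(\mathbf x)\mid \mathbf x\in\{0,1\}^n\}$. Then, with $$M=f(\mathbf x_{\mathrm{feas}})-f_{\widehat{\mathrm{unc}}}+\delta,$$ the unconstrained problem $(P_M)$ of minimizing $\mathbf x^tQ\mathbf x+M(A\mathbf x-\mathbf b)^2$ over $\mathbf x\in\{0,1\}^n$ is an exact reformulation of $(P)$ with gap at least $\delta$.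
   Context: $(A\mathbf x-\mathbf b)^2$ denotes the squared Euclidean norm $\sum_{j=1}^m (A\mathbf x-\mathbf b)_j^2$. A point $\mathbf x\in\{0,1\}^n$ is feasible if $A\mathbf x=\mathbf b$ and unfeasible otherwise. Let $\mathbf x^\ast$ be an optimal point of $(P)$. $(P_M)$ is an exact reformulation of $(P)$ if the optimal points of $(P)$ and $(P_M)$ coincide; it is an exact reformulation with gap (at least) $\delta>0$ if $f(\mathbf x^\ast)+\delta\le f(\mathbf x)+M(A\mathbf x-\mathbf b)^2$ for all unfeasible $\mathbf x\in\{0,1\}^n$. *)

theory Defs
  imports "HOL-Analysis.Finite_Cartesian_Product"
begin

definition binary_points :: "(int ^ 'n) set" where
  "binary_points = {x. \<forall>i. x $ i \<in> {0, 1}}"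

definition quad_form :: "int ^ 'n ^ 'n \<Rightarrow> int ^ 'n \<Rightarrow> int" where
  "quad_form Q x = (\<Sum>i\<in>UNIV. x $ i * (Q *v x) $ i)"

definition sq_norm :: "int ^ 'm \<Rightarrow> int" where
  "sq_norm v = (\<Sum>j\<in>UNIV. (v $ j)\<^sup>2)"

definition feasible :: "int ^ 'n ^ 'm \<Rightarrow> int ^ 'm \<Rightarrow> int ^ 'n \<Rightarrow> bool" where
  "feasible A b x \<longleftrightarrow> x \<in> binary_points \<and> A *v x = b"

definition unfeasible :: "int ^ 'n ^ 'm \<Rightarrow> int ^ 'm \<Rightarrow> int ^ 'n \<Rightarrow> bool" where
  "unfeasible A b x \<longleftrightarrow> x \<in> binary_points \<and> A *v x \<noteq> b"

definition penalized :: "int ^ 'n ^ 'n \<Rightarrow> int ^ 'n ^ 'm \<Rightarrow> int ^ 'm \<Rightarrow> real \<Rightarrow> int ^ 'n \<Rightarrow> real" where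
  "penalized Q A b M x = real_of_int (quad_form Q x) + M * real_of_int (sq_norm (A *v x - b))"

definition optimal_P :: "int ^ 'n ^ 'n \<Rightarrow> int ^ 'n ^ 'm \<Rightarrow> int ^ 'm \<Rightarrow> int ^ 'n \<Rightarrow> bool" where
  "optimal_P Q A b x \<longleftrightarrow> is_arg_min (quad_form Q) (feasible A b) x"

definition optimal_PM ::
  "int ^ 'n ^ 'n \<Rightarrow> int ^ 'n ^ 'm \<Rightarrow> int ^ 'm \<Rightarrow> real \<Rightarrow> int ^ 'n \<Rightarrow> bool" where
  "optimal_PM Q A b M x \<longleftrightarrow> is_arg_min (penalized Q A b M) (\<lambda>y. y \<in> binary_points) x"

definition exact_reformulation ::
  "int ^ 'n ^ 'n \<Rightarrow> int ^ 'n ^ 'm \<Rightarrow> int ^ 'm \<Rightarrow> real \<Rightarrow> bool" where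
  "exact_reformulation Q A b M \<longleftrightarrow> {x. optimal_P Q A b x} = {x. optimal_PM Q A b M x}"

(* All optimal points of the constrained problem have the same value, so quantifying over
   every optimal point is the same as fixing one. *)
definition exact_reformulation_with_gap ::
  "int ^ 'n ^ 'n \<Rightarrow> int ^ 'n ^ 'm \<Rightarrow> int ^ 'm \<Rightarrow> real \<Rightarrow> real \<Rightarrow> bool" where
  "exact_reformulation_with_gap Q A b M \<delta> \<longleftrightarrow>
     \<delta> > 0 \<and> exact_reformulation Q A b M \<and>
     (\<forall>xopt x. optimal_P Q A b xopt \<longrightarrow> unfeasible A b x \<longrightarrow>
        real_of_int (quad_form Q xopt) + \<delta> \<le> penalized Q A b M x)"

end

theory Submission
  imports Defs
begin

text \<open>At an unfeasible point the residual \<open>A *v x - b\<close> is a nonzero integer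
  vector, so its squared norm is at least 1 and the penalty is at least \<open>M\<close>
  (\<open>penalized_unfeasible_ge\<close>). As \<open>f_unc\<close> bounds the objective from below,
  the penalized value there is at least \<open>f_unc + M\<close>, which is the value at
  \<open>x_feas\<close> plus \<delta>. At feasible points the penalty vanishes. Hence
  \<open>x_feas\<close> beats every unfeasible point by \<delta>, minimizers of the penalized
  problem are feasible, and the two problems have the same minimizers
  (\<open>exact_reformulation_with_gapI\<close>).\<close>

text \<open>Finiteness is what makes \<open>Min\<close> over the binary points a genuine lower bound
  (\<open>Min_le\<close>).\<close>

lemma finite_binary_points: "finite (binary_points :: (int ^ 'n) set)"
proof -
  have "finite (UNIV \<rightarrow>\<^sub>E {0, 1} :: ('n \<Rightarrow> int) set)"
    by (intro finite_PiE) auto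
  then have "finite (vec_nth ` (binary_points :: (int ^ 'n) set))"
    by (rule finite_subset[rotated]) (auto simp: binary_points_def)
  then show ?thesis
    by (rule finite_imageD) (simp add: inj_on_def vec_nth_inject)
qed

text \<open>Integrality enters here: a nonzero integer entry already contributes at least 1.\<close>

lemma sq_norm_ge_1:
  assumes "v \<noteq> 0"
  shows "sq_norm v \<ge> 1"
proof -
  obtain j where "v $ j \<noteq> 0"
    using assms by (auto simp: vec_eq_iff)
  then have "1 \<le> (v $ j)\<^sup>2"
    by (simp add: int_one_le_iff_zero_less)
  also have "\<dots> \<le> sq_norm v"
    unfolding sq_norm_def by (intro member_le_sum) auto
  finally show ?thesis .
qed

lemma penalized_feasible:
  assumes "feasible A b x"
  shows "penalized Q A b M x = real_of_int (quad_form Q x)"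
  using assms by (simp add: penalized_def feasible_def sq_norm_def)

lemma penalized_unfeasible_ge:
  assumes "unfeasible A b x" and "M \<ge> 0"
  shows "real_of_int (quad_form Q x) + M \<le> penalized Q A b M x"
proof -
  have "sq_norm (A *v x - b) \<ge> 1"
    using assms(1) by (intro sq_norm_ge_1) (simp add: unfeasible_def)
  then have "M * 1 \<le> M * real_of_int (sq_norm (A *v x - b))"
    using assms(2) by (intro mult_left_mono) auto
  then show ?thesis
    by (simp add: penalized_def)
qed

text \<open>It suffices to test the gap against one feasible point, optimal or not: passing to an
  optimal point can only lower the left-hand side.\<close>

lemma exact_reformulation_with_gapI:
  assumes "feasible A b x\<^sub>0" and "\<delta> > 0"
    and gap: "\<And>x. unfeasible A b x \<Longrightarrow> real_of_int (quad_form Q x\<^sub>0) + \<delta> \<le> penalized Q A b M x"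
  shows "exact_reformulation_with_gap Q A b M \<delta>"
proof -
  have split: "x \<in> binary_points \<longleftrightarrow> feasible A b x \<or> unfeasible A b x" for x
    by (auto simp: feasible_def unfeasible_def)
  have opt_le: "quad_form Q x \<le> quad_form Q y"
    if "optimal_P Q A b x" "feasible A b y" for x y
    using that by (fastforce simp: optimal_P_def is_arg_min_def)
  have opt_gap: "real_of_int (quad_form Q x) + \<delta> \<le> penalized Q A b M y"
    if "optimal_P Q A b x" "unfeasible A b y" for x y
    using opt_le[OF that(1) assms(1)] gap[OF that(2)] by linarith
  have "optimal_PM Q A b M x" if x: "optimal_P Q A b x" for x
  proof -
    have feas: "feasible A b x"
      using x by (simp add: optimal_P_def is_arg_min_def)
    \<comment> \<open>Feasible competitors lose by optimality of \<open>x\<close>, unfeasible ones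
      by the gap.\<close>
    have "penalized Q A b M x \<le> penalized Q A b M y" if "y \<in> binary_points" for y
      using that[unfolded split]
    proof
      assume "feasible A b y"
      then show ?thesis
        using feas opt_le[OF x] by (simp add: penalized_feasible)
    next
      assume "unfeasible A b y"
      from opt_gap[OF x this] show ?thesis
        using feas \<open>\<delta> > 0\<close> by (simp add: penalized_feasible)
    qed
    then show ?thesis
      using feas by (auto simp: optimal_PM_def is_arg_min_def split not_less)
  qed
  moreover have "optimal_P Q A b x" if x: "optimal_PM Q A b M x" for x
  proof -
    have le: "penalized Q A b M x \<le> real_of_int (quad_form Q y)" if "feasible A b y" for y
      using x that penalized_feasible[OF that, of Q M]
      by (auto simp: optimal_PM_def is_arg_min_def split not_less)
    \<comment> \<open>Otherwise the penalized value of \<open>x\<close> would exceed that of the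
      feasible point \<open>x\<^sub>0\<close> by at least \<delta>.\<close>
    have "\<not> unfeasible A b x"
      using gap[of x] le[OF assms(1)] \<open>\<delta> > 0\<close> by force
    then have "feasible A b x"
      using x by (auto simp: optimal_PM_def is_arg_min_def split)
    then show ?thesis
      using le by (fastforce simp: optimal_P_def is_arg_min_def penalized_feasible)
  qed
  ultimately show ?thesis
    using opt_gap \<open>\<delta> > 0\<close>
    by (auto simp: exact_reformulation_with_gap_def exact_reformulation_def)
qed

theorem mainTheorem2:
  fixes Q :: "int ^ 'n ^ 'n" and A :: "int ^ 'n ^ 'm" and b :: "int ^ 'm"
    and x_feas :: "int ^ 'n" and \<delta> f_unc M :: real
  assumes "feasible A b x_feas"
    and "\<delta> > 0"
    and "f_unc \<le> real_of_int (Min (quad_form Q ` binary_points))"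
    and "M = real_of_int (quad_form Q x_feas) - f_unc + \<delta>"
  shows "exact_reformulation_with_gap Q A b M \<delta>"
proof -
  have f_unc_le: "f_unc \<le> real_of_int (quad_form Q x)" if "x \<in> binary_points" for x
  proof -
    have "Min (quad_form Q ` binary_points) \<le> quad_form Q x"
      using that by (intro Min_le finite_imageI finite_binary_points imageI)
    then show ?thesis
      using assms(3) by linarith
  qed
  \<comment> \<open>The point \<open>x_feas\<close> is itself binary, so \<open>f_unc\<close> is at
    most its value and \<open>M\<close> is at least \<delta>.\<close>
  have "M \<ge> 0"
    using f_unc_le[of x_feas] assms(1,2,4) by (simp add: feasible_def)
  show ?thesis
  proof (rule exact_reformulation_with_gapI[OF assms(1,2)])
    fix x
    assume x: "unfeasible A b x"
    then have "f_unc \<le> real_of_int (quad_form Q x)"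
      by (intro f_unc_le) (simp add: unfeasible_def)
    \<comment> \<open>\<open>M\<close> is chosen so that \<open>f_unc + M\<close> equals the
      left-hand side.\<close>
    then show "real_of_int (quad_form Q x_feas) + \<delta> \<le> penalized Q A b M x"
      using penalized_unfeasible_ge[OF x \<open>M \<ge> 0\<close>, of Q] assms(4) by linarith
  qed
qed

end
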